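(* Let $n\ge1$, $s\in\mathbb{R}$, $\alpha\in\mathbb{R}\setminus\pi\mathbb{Z}$, $1\le p\le\infty$ and $0<q\le\infty$, with $p<\infty$ whenever Triebel--Lizorkin or Sobolev norms are considered. For $u\in\mathcal S'(\mathbb{R}^n)$ define $$\|u\|_{B^s_{p,q,\alpha}}:=\|S_{0,\alpha}u\|_{L^p}+\Bigl(\sum_{j\ge1}\bigl(2^{js}\|\Delta_{j,\alpha}u\|_{L^p}\bigr)^q\Bigr)^{1/q},$$ $$\|u\|_{F^s_{p,q,\alpha}}:=\|S_{0,\alpha}u\|_{L^p}+\Bigl\|\Bigl(\sum_{j\ge1}\bigl(2^{js}|\Delta_{j,\alpha}u|\bigr)^q\Bigr)^{1/q}\Bigr\|_{L^p},$$ with the usual supremum interpretation when $q=\infty$, and $\|u\|_{H^{s,p}_\alpha}:=\|u\|_{F^s_{p,2,\alpha}}$. If $v=M_\alpha u$, then, whenever the corresponding classical norms are defined, $$\|u\|_{B^s_{p,q,\alpha}}=\|v\|_{B^s_{p,q}},\qquad\|u\|_{F^s_{p,q,\alpha}}=\|v\|_{F^s_{p,q}},\qquad\|u\|_{H^{s,p}_\alpha}=\|v\|_{H^{s,p}}.$$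
   Context: $M_\alpha f(x)=e^{i\pi|x|^2\cot\alpha}f(x)$, acting on tempered distributions, and $M_\alpha^{-1}$ is multiplication by $e^{-i\pi|x|^2\cot\alpha}$. With $\widehat f(\xi)=\int_{\mathbb{R}^n}e^{-2\pi ix\cdot\xi}f(x)\,dx$ and $\vee$ its inverse: fix $\varphi\in C_c^\infty(\mathbb{R}^n\setminus\{0\})$ supported in $\{\frac12\le|\xi|\le2\}$ with $\sum_{j\in\mathbb{Z}}\varphi(2^{-j}\xi)=1$ for $\xi\ne0$, and $\chi\in C_c^\infty(\mathbb{R}^n)$ supported in $\{|\xi|\le2\}$ and equal to $1$ on $\{|\xi|\le1\}$. Set $\Delta_jf:=(\varphi(2^{-j}\cdot)\widehat f)^\vee$, $S_0f:=(\chi\widehat f)^\vee$, $S_{0,\alpha}:=M_\alpha^{-1}S_0M_\alpha$ and $\Delta_{j,\alpha}:=M_\alpha^{-1}\Delta_jM_\alpha$. The classical norms $\|\cdot\|_{B^s_{p,q}}$ and $\|\cdot\|_{F^s_{p,q}}$ are given by the same formulas with $S_0,\Delta_j$ in place of $S_{0,\alpha},\Delta_{j,\alpha}$, and $\|v\|_{H^{s,p}}:=\|v\|_{F^s_{p,2}}$. *)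

theory Defs
  imports "HOL-Analysis.Analysis" "HOL-Probability.Essential_Supremum"
begin

section \<open>Smooth functions and Schwartz functions\<close>

definition partial_deriv :: "'n::finite \<Rightarrow> (real^'n \<Rightarrow> complex) \<Rightarrow> real^'n \<Rightarrow> complex" where
  "partial_deriv i f x = frechet_derivative f (at x) (axis i 1)"

fun partial_derivs :: "'n::finite list \<Rightarrow> (real^'n \<Rightarrow> complex) \<Rightarrow> real^'n \<Rightarrow> complex" where
  "partial_derivs [] f = f"
| "partial_derivs (i # is) f = partial_deriv i (partial_derivs is f)"

definition smooth :: "(real^'n::finite \<Rightarrow> complex) \<Rightarrow> bool" where
  "smooth f \<longleftrightarrow> (\<forall>is. partial_derivs is f differentiable_on UNIV)"

definition schwartz :: "(real^'n::finite \<Rightarrow> complex) set" where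
  "schwartz = {f. smooth f \<and>
     (\<forall>k is. bdd_above (range (\<lambda>x. norm x ^ k * norm (partial_derivs is f x))))}"

definition schwartz_seminorm :: "nat \<Rightarrow> 'n::finite list \<Rightarrow> (real^'n \<Rightarrow> complex) \<Rightarrow> real" where
  "schwartz_seminorm k is f = (SUP x. norm x ^ k * norm (partial_derivs is f x))"

definition schwartz_topology :: "(real^'n::finite \<Rightarrow> complex) topology" where
  "schwartz_topology = topology_generated_by
     {{g \<in> schwartz. schwartz_seminorm k is (\<lambda>x. g x - f x) < e} | f k is e.
        f \<in> schwartz \<and> e > 0}"

text \<open>\<open>test_function U\<close> is \<open>C\<^sub>c\<^sup>\<infinity>(U)\<close>, each element extended by zero to the whole space.\<close>

definition test_function :: "(real^'n::finite) set \<Rightarrow> (real^'n \<Rightarrow> complex) set" where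
  "test_function U =
     {f. smooth f \<and> compact (closure {x. f x \<noteq> 0}) \<and> closure {x. f x \<noteq> 0} \<subseteq> U}"

definition fourier :: "(real^'n::finite \<Rightarrow> complex) \<Rightarrow> real^'n \<Rightarrow> complex" where
  "fourier f \<xi> = (\<integral>x. exp (- 2 * pi * \<i> * complex_of_real (x \<bullet> \<xi>)) * f x \<partial>lborel)"

definition inv_fourier :: "(real^'n::finite \<Rightarrow> complex) \<Rightarrow> real^'n \<Rightarrow> complex" where
  "inv_fourier f x = (\<integral>\<xi>. exp (2 * pi * \<i> * complex_of_real (x \<bullet> \<xi>)) * f \<xi> \<partial>lborel)"


section \<open>Tempered distributions\<close>

text \<open>A tempered distribution is a continuous linear functional on the Schwartz space. It is
  represented by a function that is extensional (arbitrary but fixed outside \<open>schwartz\<close>), so that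
  equality of representing functions is equality of distributions; every operation below is
  therefore restricted to \<open>schwartz\<close>.\<close>

type_synonym 'n functional = "(real^'n \<Rightarrow> complex) \<Rightarrow> complex"

definition tempered :: "'n::finite functional set" where
  "tempered = {T \<in> extensional schwartz.
     (\<forall>f\<in>schwartz. \<forall>g\<in>schwartz. T (\<lambda>x. f x + g x) = T f + T g) \<and>
     (\<forall>c. \<forall>f\<in>schwartz. T (\<lambda>x. c * f x) = c * T f) \<and>
     continuous_map schwartz_topology euclidean T}"

definition fourier_distr :: "'n::finite functional \<Rightarrow> 'n functional" where
  "fourier_distr T = (\<lambda>\<psi>\<in>schwartz. T (fourier \<psi>))"

definition inv_fourier_distr :: "'n::finite functional \<Rightarrow> 'n functional" where
  "inv_fourier_distr T = (\<lambda>\<psi>\<in>schwartz. T (inv_fourier \<psi>))"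

text \<open>Multiplication by \<open>m\<close>; meaningful for smooth \<open>m\<close> all of whose derivatives have at most
  polynomial growth, which is the only case used.\<close>

definition mult_distr :: "(real^'n::finite \<Rightarrow> complex) \<Rightarrow> 'n functional \<Rightarrow> 'n functional" where
  "mult_distr m T = (\<lambda>\<psi>\<in>schwartz. T (\<lambda>x. m x * \<psi> x))"

text \<open>\<open>represents g T\<close>: the distribution \<open>T\<close> is the function \<open>g\<close>. Such a \<open>g\<close> is unique up to a null
  set, so that \<open>density_of T\<close> is well defined almost everywhere.\<close>

definition represents :: "(real^'n::finite \<Rightarrow> complex) \<Rightarrow> 'n functional \<Rightarrow> bool" where
  "represents g T \<longleftrightarrow> g \<in> borel_measurable lborel \<and>
     (\<forall>\<psi>\<in>schwartz. integrable lborel (\<lambda>x. g x * \<psi> x) \<and> T \<psi> = (\<integral>x. g x * \<psi> x \<partial>lborel))"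

definition is_function :: "'n::finite functional \<Rightarrow> bool" where
  "is_function T \<longleftrightarrow> (\<exists>g. represents g T)"

definition density_of :: "'n::finite functional \<Rightarrow> real^'n \<Rightarrow> complex" where
  "density_of T = (SOME g. represents g T)"


section \<open>Norms with values in \<open>[0, \<infinity>]\<close>\<close>

text \<open>The power \<open>x\<^sup>r\<close> of \<open>x \<in> [0, \<infinity>]\<close> for an exponent \<open>r > 0\<close>.\<close>

definition ennpowr :: "ennreal \<Rightarrow> real \<Rightarrow> ennreal" where
  "ennpowr x r = (if x = \<infinity> then \<infinity> else ennreal (enn2real x powr r))"

definition Lp_norm :: "ennreal \<Rightarrow> (real^'n::finite \<Rightarrow> ennreal) \<Rightarrow> ennreal" where
  "Lp_norm p F =
     (if p = \<infinity> then esssup lborel F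
      else ennpowr (\<integral>\<^sup>+ x. ennpowr (F x) (enn2real p) \<partial>lborel) (1 / enn2real p))"

definition lq_norm :: "ennreal \<Rightarrow> (int \<Rightarrow> ennreal) \<Rightarrow> ennreal" where
  "lq_norm q a =
     (if q = \<infinity> then (SUP j\<in>{1..}. a j)
      else ennpowr (\<Sum>\<^sub>\<infinity>j\<in>{1..}. ennpowr (a j) (enn2real q)) (1 / enn2real q))"

text \<open>The \<open>L\<^sup>p\<close> norm of a distribution; it is infinite if the distribution is not a function.\<close>

definition Lp_norm_distr :: "ennreal \<Rightarrow> 'n::finite functional \<Rightarrow> ennreal" where
  "Lp_norm_distr p T =
     (if is_function T then Lp_norm p (\<lambda>x. ennreal (norm (density_of T x))) else \<infinity>)"


section \<open>Littlewood--Paley operators and their chirp conjugates\<close>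

definition dyadic_cutoff :: "(real^'n::finite \<Rightarrow> complex) \<Rightarrow> bool" where
  "dyadic_cutoff \<phi> \<longleftrightarrow>
     \<phi> \<in> test_function (UNIV - {0}) \<and>
     closure {\<xi>. \<phi> \<xi> \<noteq> 0} \<subseteq> {\<xi>. 1/2 \<le> norm \<xi> \<and> norm \<xi> \<le> 2} \<and>
     (\<forall>\<xi>. \<xi> \<noteq> 0 \<longrightarrow> ((\<lambda>j::int. \<phi> ((2 powi (- j)) *\<^sub>R \<xi>)) has_sum 1) UNIV)"

definition low_cutoff :: "(real^'n::finite \<Rightarrow> complex) \<Rightarrow> bool" where
  "low_cutoff chi \<longleftrightarrow>
     chi \<in> test_function UNIV \<and>
     closure {\<xi>. chi \<xi> \<noteq> 0} \<subseteq> {\<xi>. norm \<xi> \<le> 2} \<and>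
     (\<forall>\<xi>. norm \<xi> \<le> 1 \<longrightarrow> chi \<xi> = 1)"

definition LP_block :: "(real^'n::finite \<Rightarrow> complex) \<Rightarrow> int \<Rightarrow> 'n functional \<Rightarrow> 'n functional" where
  "LP_block \<phi> j f =
     inv_fourier_distr (mult_distr (\<lambda>\<xi>. \<phi> ((2 powi (- j)) *\<^sub>R \<xi>)) (fourier_distr f))"

definition LP_low :: "(real^'n::finite \<Rightarrow> complex) \<Rightarrow> 'n functional \<Rightarrow> 'n functional" where
  "LP_low chi f = inv_fourier_distr (mult_distr chi (fourier_distr f))"

definition chirp_mult :: "real \<Rightarrow> 'n::finite functional \<Rightarrow> 'n functional" where
  "chirp_mult \<alpha> = mult_distr (\<lambda>x. exp (\<i> * complex_of_real (pi * (norm x)\<^sup>2 * cot \<alpha>)))"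

definition chirp_mult_inv :: "real \<Rightarrow> 'n::finite functional \<Rightarrow> 'n functional" where
  "chirp_mult_inv \<alpha> = mult_distr (\<lambda>x. exp (- \<i> * complex_of_real (pi * (norm x)\<^sup>2 * cot \<alpha>)))"

definition LP_block_chirp ::
    "(real^'n::finite \<Rightarrow> complex) \<Rightarrow> real \<Rightarrow> int \<Rightarrow> 'n functional \<Rightarrow> 'n functional" where
  "LP_block_chirp \<phi> \<alpha> j u = chirp_mult_inv \<alpha> (LP_block \<phi> j (chirp_mult \<alpha> u))"

definition LP_low_chirp ::
    "(real^'n::finite \<Rightarrow> complex) \<Rightarrow> real \<Rightarrow> 'n functional \<Rightarrow> 'n functional" where
  "LP_low_chirp chi \<alpha> u = chirp_mult_inv \<alpha> (LP_low chi (chirp_mult \<alpha> u))"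


section \<open>Besov, Triebel--Lizorkin and Sobolev norms\<close>

text \<open>The common formulas, for a low-frequency piece \<open>S\<close> and dyadic pieces \<open>D j\<close>, \<open>j \<ge> 1\<close>.\<close>

definition besov_formula ::
    "real \<Rightarrow> ennreal \<Rightarrow> ennreal \<Rightarrow> 'n::finite functional \<Rightarrow> (int \<Rightarrow> 'n functional) \<Rightarrow> ennreal" where
  "besov_formula s p q S D =
     Lp_norm_distr p S
     + lq_norm q (\<lambda>j. ennreal (2 powr (of_int j * s)) * Lp_norm_distr p (D j))"

text \<open>As for \<^const>\<open>Lp_norm_distr\<close>, the value is infinite unless all pieces are functions. For the
  Littlewood--Paley pieces of a tempered distribution this exceptional case does not occur: they
  have compactly supported Fourier transforms.\<close>

definition triebel_formula ::
    "real \<Rightarrow> ennreal \<Rightarrow> ennreal \<Rightarrow> 'n::finite functional \<Rightarrow> (int \<Rightarrow> 'n functional) \<Rightarrow> ennreal" where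
  "triebel_formula s p q S D =
     Lp_norm_distr p S
     + (if \<forall>j\<ge>1. is_function (D j)
        then Lp_norm p (\<lambda>x. lq_norm q
               (\<lambda>j. ennreal (2 powr (of_int j * s)) * ennreal (norm (density_of (D j) x))))
        else \<infinity>)"

definition besov_norm ::
    "(real^'n::finite \<Rightarrow> complex) \<Rightarrow> (real^'n \<Rightarrow> complex) \<Rightarrow> real \<Rightarrow> ennreal \<Rightarrow> ennreal \<Rightarrow> 'n functional \<Rightarrow> ennreal" where
  "besov_norm \<phi> chi s p q v = besov_formula s p q (LP_low chi v) (\<lambda>j. LP_block \<phi> j v)"

definition triebel_norm ::
    "(real^'n::finite \<Rightarrow> complex) \<Rightarrow> (real^'n \<Rightarrow> complex) \<Rightarrow> real \<Rightarrow> ennreal \<Rightarrow> ennreal \<Rightarrow> 'n functional \<Rightarrow> ennreal" where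
  "triebel_norm \<phi> chi s p q v = triebel_formula s p q (LP_low chi v) (\<lambda>j. LP_block \<phi> j v)"

definition sobolev_norm ::
    "(real^'n::finite \<Rightarrow> complex) \<Rightarrow> (real^'n \<Rightarrow> complex) \<Rightarrow> real \<Rightarrow> ennreal \<Rightarrow> 'n functional \<Rightarrow> ennreal" where
  "sobolev_norm \<phi> chi s p v = triebel_norm \<phi> chi s p 2 v"

definition besov_norm_chirp ::
    "(real^'n::finite \<Rightarrow> complex) \<Rightarrow> (real^'n \<Rightarrow> complex) \<Rightarrow> real \<Rightarrow> real \<Rightarrow> ennreal \<Rightarrow> ennreal \<Rightarrow> 'n functional \<Rightarrow> ennreal" where
  "besov_norm_chirp \<phi> chi \<alpha> s p q u =
     besov_formula s p q (LP_low_chirp chi \<alpha> u) (\<lambda>j. LP_block_chirp \<phi> \<alpha> j u)"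

definition triebel_norm_chirp ::
    "(real^'n::finite \<Rightarrow> complex) \<Rightarrow> (real^'n \<Rightarrow> complex) \<Rightarrow> real \<Rightarrow> real \<Rightarrow> ennreal \<Rightarrow> ennreal \<Rightarrow> 'n functional \<Rightarrow> ennreal" where
  "triebel_norm_chirp \<phi> chi \<alpha> s p q u =
     triebel_formula s p q (LP_low_chirp chi \<alpha> u) (\<lambda>j. LP_block_chirp \<phi> \<alpha> j u)"

definition sobolev_norm_chirp ::
    "(real^'n::finite \<Rightarrow> complex) \<Rightarrow> (real^'n \<Rightarrow> complex) \<Rightarrow> real \<Rightarrow> real \<Rightarrow> ennreal \<Rightarrow> 'n functional \<Rightarrow> ennreal" where
  "sobolev_norm_chirp \<phi> chi \<alpha> s p u = triebel_norm_chirp \<phi> chi \<alpha> s p 2 u"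

end

theory Submission
  imports Defs "HOL-Real_Asymp.Real_Asymp"
begin

text \<open>The pieces of the chirp norm of \<open>u\<close> are \<open>M\<^sub>\<alpha>\<^sup>-\<^sup>1\<close> applied to the classical pieces of \<open>v\<close>. Since the
  chirp is unimodular, this leaves absolute values unchanged, so only the passage between tempered
  distributions and functions needs an argument: multiplication by a chirp preserves the Schwartz
  space, hence maps the function representing \<open>T\<close> to one representing \<open>M\<^sub>\<alpha>\<^sup>-\<^sup>1 T\<close>, and a representing
  function is unique almost everywhere. For the latter, if \<open>d\<close> is orthogonal to all Schwartz functions, then
  \<open>k = d exp (- |x|\<^sup>2)\<close> is integrable and orthogonal to products of logistic functions of the coordinates;
  these converge boundedly to indicators of orthants, which generate the Borel sets.\<close>

section \<open>Partial derivatives, rapid decay and membership in the Schwartz space\<close>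

lemma partial_deriv_eq:
  assumes "\<And>x. (f has_derivative f' x) (at x)"
  shows "partial_deriv i f = (\<lambda>x. f' x (axis i 1))"
  using frechet_derivative_at[OF assms] by (auto simp: partial_deriv_def fun_eq_iff)

lemma partial_deriv_add:
  assumes "\<And>x. f differentiable (at x)" "\<And>x. g differentiable (at x)"
  shows "partial_deriv i (\<lambda>x. f x + g x) = (\<lambda>x. partial_deriv i f x + partial_deriv i g x)"
  using assms by (subst partial_deriv_eq)
    (auto intro!: derivative_eq_intros simp: partial_deriv_def frechet_derivative_works)

lemma partial_deriv_mult:
  assumes "\<And>x. f differentiable (at x)" "\<And>x. g differentiable (at x)"
  shows "partial_deriv i (\<lambda>x. f x * g x) =
    (\<lambda>x. f x * partial_deriv i g x + partial_deriv i f x * g x)"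
  using assms by (subst partial_deriv_eq)
    (auto intro!: derivative_eq_intros simp: partial_deriv_def frechet_derivative_works)

definition rapid :: "(real^'n::finite \<Rightarrow> complex) \<Rightarrow> bool" where
  "rapid f \<longleftrightarrow> (\<forall>k. \<exists>B. \<forall>x. norm x ^ k * norm (f x) \<le> B)"

lemma rapid_iff_bdd_above:
  "rapid f \<longleftrightarrow> (\<forall>k. bdd_above (range (\<lambda>x. norm x ^ k * norm (f x))))"
  by (auto simp: rapid_def bdd_above_def)

lemma rapid_add:
  assumes "rapid f" "rapid g"
  shows "rapid (\<lambda>x. f x + g x)"
  unfolding rapid_def
proof
  fix k
  obtain B C where "\<And>x. norm x ^ k * norm (f x) \<le> B" "\<And>x. norm x ^ k * norm (g x) \<le> C"
    using assms unfolding rapid_def by metis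
  then have "norm x ^ k * norm (f x + g x) \<le> B + C" for x
    by (smt (verit, best) distrib_left mult_left_mono norm_ge_zero norm_triangle_ineq zero_le_power)
  then show "\<exists>B. \<forall>x. norm x ^ k * norm (f x + g x) \<le> B" by blast
qed

text \<open>A set closed under \<open>partial_deriv\<close> contains all iterated partial
  derivatives of its members, so bounds on the members suffice and no formula for higher derivatives
  of \<open>f\<close> is required.\<close>

lemma schwartz_coinduct [consumes 1, case_names differentiable partial_deriv rapid]:
  assumes "f \<in> A"
    and diff: "\<And>f x. f \<in> A \<Longrightarrow> f differentiable (at x)"
    and deriv: "\<And>f i. f \<in> A \<Longrightarrow> partial_deriv i f \<in> A"
    and rapid: "\<And>f. f \<in> A \<Longrightarrow> rapid f"
  shows "f \<in> schwartz"
proof -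
  have "partial_derivs is f \<in> A" for "is"
    by (induction "is") (use assms in auto)
  then show ?thesis
    using diff rapid unfolding schwartz_def smooth_def differentiable_on_def rapid_iff_bdd_above by simp
qed

lemma schwartz_partial_derivs:
  assumes "f \<in> schwartz"
  shows "partial_derivs is f differentiable (at x)" "rapid (partial_derivs is f)"
  using assms by (auto simp: schwartz_def smooth_def differentiable_on_def rapid_iff_bdd_above)

section \<open>Multipliers of the Schwartz space\<close>

text \<open>An algebra of smooth functions of polynomial growth that is closed under partial derivatives by
  construction: the derivative of a logistic function \<open>\<sigma>\<close> is a multiple of \<open>\<sigma> (1 - \<sigma>)\<close>. It contains
  the chirps, which are the Gaussians with purely imaginary exponent.\<close>

inductive_set moderate :: "(real^'n::finite \<Rightarrow> complex) set" where
  const: "(\<lambda>x. c) \<in> moderate"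
| coord: "(\<lambda>x. complex_of_real (x $ i)) \<in> moderate"
| gaussian: "Re z \<le> 0 \<Longrightarrow> (\<lambda>x. exp (z * complex_of_real ((norm x)\<^sup>2))) \<in> moderate"
| logistic: "(\<lambda>x. complex_of_real (1 / (1 + exp (a * x $ i + b)))) \<in> moderate"
| add: "f \<in> moderate \<Longrightarrow> g \<in> moderate \<Longrightarrow> (\<lambda>x. f x + g x) \<in> moderate"
| mult: "f \<in> moderate \<Longrightarrow> g \<in> moderate \<Longrightarrow> (\<lambda>x. f x * g x) \<in> moderate"

lemma has_derivative_nth: "((\<lambda>x::real^'n::finite. complex_of_real (x $ i)) has_derivative (\<lambda>h. complex_of_real (h $ i))) (at x)"
  by (intro bounded_linear_imp_has_derivative bounded_linear_compose[OF bounded_linear_of_real bounded_linear_vec_nth])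

text \<open>The squared norm is differentiated as \<open>x \<bullet> x\<close>, because
  \<open>norm\<close> itself is not differentiable at the origin.\<close>

lemma has_derivative_gaussian:
  "((\<lambda>x::real^'n::finite. exp (z * complex_of_real ((norm x)\<^sup>2))) has_derivative
     (\<lambda>h. exp (z * complex_of_real ((norm x)\<^sup>2)) * (z * complex_of_real (2 * (x \<bullet> h))))) (at x)"
proof -
  have "((\<lambda>x::real^'n. z * complex_of_real (x \<bullet> x)) has_derivative
     (\<lambda>h. z * complex_of_real (2 * (x \<bullet> h)))) (at x)"
    by (rule derivative_eq_intros refl has_derivative_compose[OF _ bounded_linear_imp_has_derivative[OF bounded_linear_of_real]])+
       (simp add: inner_commute)
  from has_derivative_compose[OF this, of exp "(*) (exp (z * complex_of_real (x \<bullet> x)))"]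
  show ?thesis
    by (simp add: power2_norm_eq_inner DERIV_exp[unfolded has_field_derivative_def])
qed

text \<open>The derivative is spelled out with sums and products only, even for the difference
  \<open>1 - \<sigma>\<close>, so that it matches the introduction rules of \<open>moderate\<close>
  literally.\<close>

lemma has_derivative_logistic:
  "((\<lambda>x::real^'n::finite. complex_of_real (1 / (1 + exp (a * x $ i + b)))) has_derivative
     (\<lambda>h. complex_of_real (h $ i) * (complex_of_real (- a) *
        (complex_of_real (1 / (1 + exp (a * x $ i + b))) *
         (1 + complex_of_real (- 1) * complex_of_real (1 / (1 + exp (a * x $ i + b))))))) ) (at x)"
proof -
  have pos: "1 + exp (a * x $ i + b) \<noteq> 0"
    by (smt (verit) exp_gt_zero)
  have "((\<lambda>x::real^'n. 1 / (1 + exp (a * x $ i + b))) has_derivative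
     (\<lambda>h. h $ i * (- a * (1 / (1 + exp (a * x $ i + b)) * (1 - 1 / (1 + exp (a * x $ i + b))))))) (at x)"
    using pos
    by (auto intro!: derivative_eq_intros bounded_linear_imp_has_derivative[OF bounded_linear_vec_nth] simp: fun_eq_iff field_simps power2_eq_square)
  from has_derivative_compose[OF this bounded_linear_imp_has_derivative[OF bounded_linear_of_real[where ?'a=complex]]]
  show ?thesis by simp
qed

lemma moderate_differentiable: "f \<in> moderate \<Longrightarrow> f differentiable (at x)"
  by (induction rule: moderate.induct)
    (auto intro!: differentiable_add differentiable_mult
      intro: differentiableI has_derivative_nth has_derivative_gaussian has_derivative_logistic simp del: of_real_divide of_real_power)

lemma moderate_partial_deriv: "f \<in> moderate \<Longrightarrow> partial_deriv i f \<in> moderate"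
proof (induction rule: moderate.induct)
  case (const c)
  have "partial_deriv i (\<lambda>x. c) = (\<lambda>_. 0)" by (subst partial_deriv_eq) auto
  then show ?case by (simp add: moderate.const)
next
  case (coord j)
  show ?case by (simp add: partial_deriv_eq[OF has_derivative_nth] moderate.const)
next
  case (gaussian z)
  then show ?case
    unfolding partial_deriv_eq[OF has_derivative_gaussian]
    by (simp add: inner_axis moderate.intros del: of_real_power)
next
  case (logistic a j b)
  then show ?case
    unfolding partial_deriv_eq[OF has_derivative_logistic]
    by (intro moderate.intros)
next
  case (add f g)
  then show ?case by (simp add: partial_deriv_add moderate_differentiable moderate.intros)
next
  case (mult f g)
  then show ?case by (simp add: partial_deriv_mult moderate_differentiable moderate.intros)
qed

text \<open>Powers of \<open>1 + norm x\<close> increase with the exponent, since the base is at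
  least 1; hence \<open>m + l\<close> serves for sums as well as for products.\<close>

lemma moderate_poly_growth:
  fixes f :: "real^'n::finite \<Rightarrow> complex"
  assumes "f \<in> moderate"
  shows "\<exists>C m. 0 \<le> C \<and> (\<forall>x. norm (f x) \<le> C * (1 + norm x) ^ m)"
  using assms
proof (induction rule: moderate.induct)
  case (const c)
  show ?case by (intro exI[of _ "norm c"] exI[of _ 0]) auto
next
  case (coord i)
  have "\<bar>x $ i\<bar> \<le> 1 + norm x" for x :: "real^'n"
    using component_le_norm_cart[of x i] by linarith
  then show ?case by (intro exI[of _ 1]) (auto intro!: exI[of _ 1])
next
  case (gaussian z)
  then have "Re z * (norm x)\<^sup>2 \<le> 0" for x :: "real^'n" by (simp add: mult_nonpos_nonneg)
  then show ?case by (intro exI[of _ 1] exI[of _ 0]) (auto simp del: of_real_power)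
next
  case (logistic a i b)
  have "norm (complex_of_real (1 / (1 + exp (a * x $ i + b)))) \<le> 1" for x :: "real^'n"
    unfolding norm_of_real by (simp add: add_pos_pos)
  then show ?case by (intro exI[of _ 1] exI[of _ 0]) (auto simp del: of_real_divide)
next
  case (add f g)
  then obtain C m D l where *: "0 \<le> C" "0 \<le> D" "\<And>x. norm (f x) \<le> C * (1 + norm x) ^ m"
    "\<And>x. norm (g x) \<le> D * (1 + norm x) ^ l" by metis
  have "norm (f x + g x) \<le> (C + D) * (1 + norm x) ^ (m + l)" for x
  proof -
    have "C * (1 + norm x) ^ m \<le> C * (1 + norm x) ^ (m + l)" "D * (1 + norm x) ^ l \<le> D * (1 + norm x) ^ (m + l)"
      using *(1,2) by (auto intro!: mult_left_mono power_increasing)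
    then show ?thesis
      using *(3,4)[of x] norm_triangle_ineq[of "f x" "g x"] by (simp add: distrib_right)
  qed
  then show ?case using * by (intro exI[of _ "C + D"] exI[of _ "m + l"]) auto
next
  case (mult f g)
  then obtain C m D l where *: "0 \<le> C" "0 \<le> D" "\<And>x. norm (f x) \<le> C * (1 + norm x) ^ m"
    "\<And>x. norm (g x) \<le> D * (1 + norm x) ^ l" by metis
  have "norm (f x * g x) \<le> (C * D) * (1 + norm x) ^ (m + l)" for x
    using mult_mono[OF *(3,4)[of x]] *(1,2) by (simp add: norm_mult power_add mult_ac)
  then show ?case using * by (intro exI[of _ "C * D"] exI[of _ "m + l"]) auto
qed

text \<open>Growth of order \<open>m\<close> in the multiplier is paid for by decay of order
  \<open>k + m\<close> in \<open>f\<close>.\<close>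

lemma rapid_moderate_mult:
  assumes "h \<in> moderate" "rapid f"
  shows "rapid (\<lambda>x. h x * f x)"
  unfolding rapid_def
proof
  fix k
  obtain C m where C: "0 \<le> C" "\<And>x. norm (h x) \<le> C * (1 + norm x) ^ m"
    using moderate_poly_growth[OF assms(1)] by blast
  obtain B D where BD: "\<And>x. norm x ^ k * norm (f x) \<le> B" "\<And>x. norm x ^ (k + m) * norm (f x) \<le> D"
    using assms(2) unfolding rapid_def by metis
  have pow: "(1 + t) ^ m \<le> 2 ^ m * (1 + t ^ m)" if "0 \<le> t" for t :: real
  proof (cases "t \<le> 1")
    case True
    then have "(1 + t) ^ m \<le> 2 ^ m" using that by (intro power_mono) auto
    also have "\<dots> \<le> 2 ^ m * (1 + t ^ m)" using that by simp
    finally show ?thesis .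
  next
    case False
    then have "(1 + t) ^ m \<le> (2 * t) ^ m" using that by (intro power_mono) auto
    also have "\<dots> \<le> 2 ^ m * (1 + t ^ m)" by (simp add: power_mult_distrib)
    finally show ?thesis .
  qed
  have "norm x ^ k * norm (h x * f x) \<le> C * 2 ^ m * (B + D)" for x
  proof -
    have "norm (h x) \<le> C * (2 ^ m * (1 + norm x ^ m))"
      using C(2)[of x] mult_left_mono[OF pow[of "norm x"] C(1)] by simp
    then have "norm (h x) * (norm x ^ k * norm (f x)) \<le> C * (2 ^ m * (1 + norm x ^ m)) * (norm x ^ k * norm (f x))"
      by (rule mult_right_mono) simp
    also have "\<dots> = C * 2 ^ m * (norm x ^ k * norm (f x) + norm x ^ (k + m) * norm (f x))"
      by (simp add: algebra_simps power_add)
    also have "\<dots> \<le> C * 2 ^ m * (B + D)"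
      using BD C(1) by (intro mult_left_mono add_mono) auto
    finally show ?thesis by (simp add: norm_mult mult_ac)
  qed
  then show "\<exists>B. \<forall>x. norm x ^ k * norm (h x * f x) \<le> B" by blast
qed

text \<open>Differentiating \<open>h * f\<close> produces derivatives of \<open>f\<close>, so the
  products \<open>h * f\<close> alone are not closed under \<open>partial_deriv\<close>. Finite sums
  over all iterated derivatives of \<open>f\<close> are, by the Leibniz rule.\<close>

inductive_set moderate_span :: "(real^'n::finite \<Rightarrow> complex) \<Rightarrow> (real^'n \<Rightarrow> complex) set"
  for f where
  base: "h \<in> moderate \<Longrightarrow> (\<lambda>x. h x * partial_derivs is f x) \<in> moderate_span f"
| add: "g \<in> moderate_span f \<Longrightarrow> h \<in> moderate_span f \<Longrightarrow> (\<lambda>x. g x + h x) \<in> moderate_span f"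

lemma moderate_mult_schwartz:
  assumes "h \<in> moderate" "f \<in> schwartz"
  shows "(\<lambda>x. h x * f x) \<in> schwartz"
proof -
  have "(\<lambda>x. h x * f x) \<in> moderate_span f"
    using moderate_span.base[OF assms(1), of "[]" f] by simp
  moreover have diff: "g differentiable (at x)" if "g \<in> moderate_span f" for g x
    using that
    by induction
      (simp_all add: moderate_differentiable schwartz_partial_derivs assms)
  moreover have "partial_deriv i g \<in> moderate_span f" if "g \<in> moderate_span f" for g i
    using that
  proof induction
    case (base h "is")
    have "(\<lambda>x. h x * partial_derivs (i # is) f x + partial_deriv i h x * partial_derivs is f x)
        \<in> moderate_span f"
      using base by (intro moderate_span.intros moderate_partial_deriv)
    then show ?case
      using base by (simp add: partial_deriv_mult moderate_differentiable schwartz_partial_derivs assms)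
  qed (auto simp: partial_deriv_add diff moderate_span.add)
  moreover have "rapid g" if "g \<in> moderate_span f" for g
    using that by induction
      (auto intro: rapid_add rapid_moderate_mult schwartz_partial_derivs assms)
  ultimately show ?thesis
    by (rule schwartz_coinduct)
qed

section \<open>Test functions damped by a Gaussian\<close>

abbreviation std_gaussian :: "real^'n::finite \<Rightarrow> complex" where
  "std_gaussian \<equiv> \<lambda>x. exp ((- 1) * complex_of_real ((norm x)\<^sup>2))"

lemma rapid_std_gaussian: "rapid std_gaussian"
  unfolding rapid_def
proof
  fix k
  have "eventually (\<lambda>t::real. t ^ k * exp (- (t\<^sup>2)) \<le> 1) at_top"
    by real_asymp
  then obtain T where T: "\<And>t. t \<ge> T \<Longrightarrow> t ^ k * exp (- (t\<^sup>2)) \<le> (1::real)"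
    unfolding eventually_at_top_linorder by blast
  \<comment> \<open>The summand 1 bounds the tail and \<open>\<bar>T\<bar> ^ k\<close> the initial
    segment; the absolute value keeps the latter nonnegative if \<open>T\<close> is
    negative.\<close>
  have "t ^ k * exp (- (t\<^sup>2)) \<le> 1 + \<bar>T\<bar> ^ k" if "0 \<le> t" for t :: real
  proof (cases "t \<ge> T")
    case True
    then show ?thesis using T[of t] by (simp add: add_increasing2)
  next
    case False
    then have "t ^ k * exp (- (t\<^sup>2)) \<le> \<bar>T\<bar> ^ k * 1"
      using that by (intro mult_mono power_mono) auto
    then show ?thesis by simp
  qed
  then show "\<exists>B. \<forall>x::real^'n. norm x ^ k * norm (std_gaussian x) \<le> B"
    by (intro exI[of _ "1 + \<bar>T\<bar> ^ k"]) (simp del: of_real_power)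
qed

text \<open>A partial derivative of the Gaussian is a coordinate multiple of the Gaussian, so here
  the set of single products is already closed under differentiation.\<close>

lemma moderate_mult_std_gaussian:
  fixes h :: "real^'n::finite \<Rightarrow> complex"
  shows "h \<in> moderate \<Longrightarrow> (\<lambda>x. h x * std_gaussian x) \<in> schwartz"
proof (rule schwartz_coinduct[of _ "{(\<lambda>x. h x * std_gaussian x) | h. h \<in> moderate}"], blast, safe)
  fix h :: "real^'n \<Rightarrow> complex" and i :: 'n and x assume h: "h \<in> moderate"
  have g: "std_gaussian \<in> (moderate :: (real^'n \<Rightarrow> complex) set)"
    by (rule moderate.gaussian) simp
  show "(\<lambda>x. h x * std_gaussian x) differentiable at x"
    using h g by (intro moderate_differentiable moderate.mult)
  show "rapid (\<lambda>x. h x * std_gaussian x)"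
    using h by (intro rapid_moderate_mult rapid_std_gaussian)
  have "partial_deriv i std_gaussian = (\<lambda>x. (- 2) * complex_of_real (x $ i) * std_gaussian x)"
    unfolding partial_deriv_eq[OF has_derivative_gaussian] by (simp add: inner_axis mult_ac)
  then have "partial_deriv i (\<lambda>x. h x * std_gaussian x) =
      (\<lambda>x. (h x * ((- 2) * complex_of_real (x $ i)) + partial_deriv i h x) * std_gaussian x)"
    unfolding partial_deriv_mult[OF moderate_differentiable[OF h] moderate_differentiable[OF g]]
    by (simp add: algebra_simps)
  moreover have "(\<lambda>x. h x * ((- 2) * complex_of_real (x $ i)) + partial_deriv i h x) \<in> moderate"
    using h by (intro moderate.intros moderate_partial_deriv)
  ultimately show "\<exists>h'. partial_deriv i (\<lambda>x. h x * std_gaussian x) = (\<lambda>x. h' x * std_gaussian x) \<and> h' \<in> moderate"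
    by (intro exI conjI)
qed

section \<open>Almost everywhere uniqueness of the representing function\<close>

text \<open>The shift by \<open>N\<close> of the exponent makes the limit 1 on the boundary \<open>x $ i = a $ i\<close> as well,
  so that the indicator of the closed orthant is a limit everywhere, not just almost everywhere.\<close>

definition smooth_orthant :: "nat \<Rightarrow> real^'n::finite \<Rightarrow> real^'n \<Rightarrow> complex" where
  "smooth_orthant N a x =
     (\<Prod>i\<in>UNIV. complex_of_real
        (1 / (1 + exp ((real N)\<^sup>2 * x $ i + (- ((real N)\<^sup>2 * a $ i) - real N)))))"

lemma moderate_prod:
  "finite I \<Longrightarrow> (\<And>i. i \<in> I \<Longrightarrow> f i \<in> moderate) \<Longrightarrow> (\<lambda>x. \<Prod>i\<in>I. f i x) \<in> moderate"
  by (induction rule: finite_induct) (auto intro: moderate.const moderate.mult)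

lemma smooth_orthant_moderate: "smooth_orthant N a \<in> moderate"
  unfolding smooth_orthant_def by (intro moderate_prod moderate.logistic) auto

lemma norm_smooth_orthant_le_1: "norm (smooth_orthant N a x) \<le> 1"
  unfolding smooth_orthant_def prod_norm[symmetric] norm_of_real
  by (intro prod_le_1) (auto simp: add_pos_pos)

text \<open>In each coordinate the exponent is \<open>N^2 * (x $ i - a $ i) - N\<close>. It is at
  most \<open>- N\<close> if \<open>x $ i \<le> a $ i\<close>; otherwise the quadratic term
  outweighs the shift and the exponent tends to infinity.\<close>

lemma smooth_orthant_tendsto:
  "(\<lambda>N. smooth_orthant N a x) \<longlonglongrightarrow> indicator {..a} x"
proof -
  have lim: "(\<lambda>N. 1 / (1 + exp ((real N)\<^sup>2 * s + (- ((real N)\<^sup>2 * t) - real N))))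
      \<longlonglongrightarrow> (if s \<le> t then 1 else 0)" for s t
  proof (cases "s \<le> t")
    case True
    have "filterlim (\<lambda>N. - real N) at_bot sequentially" by real_asymp
    then have "filterlim (\<lambda>N. (real N)\<^sup>2 * s + (- ((real N)\<^sup>2 * t) - real N)) at_bot sequentially"
      by (rule filterlim_at_bot_mono) (use True in \<open>auto intro!: always_eventually simp: mult_left_mono\<close>)
    then have "(\<lambda>N. 1 / (1 + exp ((real N)\<^sup>2 * s + (- ((real N)\<^sup>2 * t) - real N)))) \<longlonglongrightarrow> 1 / (1 + 0)"
      by (intro tendsto_intros filterlim_compose[OF exp_at_bot]) auto
    then show ?thesis using True by simp
  next
    case False
    then obtain d where d: "d > 0" "s = t + d"
      using that[of "s - t"] by simp
    have "(\<lambda>N. 1 / (1 + exp ((real N)\<^sup>2 * d - real N))) \<longlonglongrightarrow> 0"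
      using d(1) by real_asymp
    then show ?thesis using d by (simp add: algebra_simps)
  qed
  have "(\<lambda>N. smooth_orthant N a x) \<longlonglongrightarrow> (\<Prod>i\<in>UNIV. complex_of_real (if x $ i \<le> a $ i then 1 else 0))"
    unfolding smooth_orthant_def by (intro tendsto_prod tendsto_of_real lim)
  also have "(\<Prod>i\<in>UNIV. complex_of_real (if x $ i \<le> a $ i then 1 else 0)) = indicator {..a} x"
    by (auto simp: indicator_def less_eq_vec_def)
  finally show ?thesis .
qed

text \<open>The Borel sets over which \<open>k\<close> integrates to zero form a Dynkin system:
  \<open>total\<close> gives complements, countable additivity gives disjoint unions. Orthants
  generate the Borel sets and are closed under intersection, so every Borel set qualifies.\<close>

lemma AE_zero_if_orthant_integrals_zero:
  fixes k :: "real^'n::finite \<Rightarrow> complex"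
  assumes k: "integrable lborel k" and total: "(\<integral>x. k x \<partial>lborel) = 0"
    and orth: "\<And>a. (LINT x:{..a}|lborel. k x) = 0"
  shows "AE x in lborel. k x = 0"
proof -
  have k': "set_integrable lborel A k" if "A \<in> sets borel" for A
    using k that by (simp add: set_integrable_def integrable_mult_indicator)
  have zero: "(LINT x:A|lborel. k x) = 0" if "A \<in> sets lborel" for A
  proof -
    have "A \<in> sigma_sets UNIV (range (\<lambda>a::real^'n. {..a}))"
      using that by (simp add: borel_eq_atMost)
    have "Int_stable (range (\<lambda>a::real^'n. {..a}))"
      unfolding Int_stable_def
    proof safe
      fix a b :: "real^'n"
      have "{..a} \<inter> {..b} = {..inf a b}" by auto
      then show "{..a} \<inter> {..b} \<in> range atMost" by blast
    qed
    have borel: "sigma_sets UNIV (range (\<lambda>a::real^'n. {..a})) = sets borel"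
      by (simp add: borel_eq_atMost)
    have closed: "range (\<lambda>a::real^'n. {..a}) \<subseteq> Pow UNIV" by simp
    from \<open>Int_stable _\<close> closed \<open>A \<in> sigma_sets _ _\<close> show ?thesis
    proof (induction rule: sigma_sets_induct_disjoint)
      case empty
      show ?case by (simp add: set_lebesgue_integral_def)
    next
      case (compl A)
      then have A: "A \<in> sets borel" by (simp add: borel)
      then have "(LINT x:A \<union> - A|lborel. k x) = (LINT x:A|lborel. k x) + (LINT x:- A|lborel. k x)"
        by (intro set_integral_Un k') auto
      then show ?case using total compl by (simp add: Compl_eq_Diff_UNIV[symmetric] set_lebesgue_integral_def)
    next
      case (union A)
      then have "(LINT x:(\<Union>i. A i)|lborel. k x) = (\<Sum>i. (LINT x:(A i)|lborel. k x))"
        by (intro lebesgue_integral_countable_add k') (auto simp: disjoint_family_on_def borel)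
      then show ?case using union by simp
    qed (auto simp: orth)
  qed
  \<comment> \<open>\<open>density_unique_real\<close> compares real densities, hence the split into
    real and imaginary parts.\<close>
  have "AE x in lborel. Re (k x) = 0"
  proof (rule density_unique_real)
    fix A :: "(real^'n) set" assume A: "A \<in> sets lborel"
    have "(LINT x:A|lborel. Re (k x)) = Re (LINT x:A|lborel. k x)"
      using k'[of A] A unfolding set_lebesgue_integral_def set_integrable_def
      by (subst integral_Re[symmetric]) auto
    then show "(LINT x:A|lborel. Re (k x)) = (LINT x:A|lborel. 0)"
      using zero[OF A] by (simp add: set_lebesgue_integral_def)
  qed (use k in auto)
  moreover have "AE x in lborel. Im (k x) = 0"
  proof (rule density_unique_real)
    fix A :: "(real^'n) set" assume A: "A \<in> sets lborel"
    have "(LINT x:A|lborel. Im (k x)) = Im (LINT x:A|lborel. k x)"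
      using k'[of A] A unfolding set_lebesgue_integral_def set_integrable_def
      by (subst integral_Im[symmetric]) auto
    then show "(LINT x:A|lborel. Im (k x)) = (LINT x:A|lborel. 0)"
      using zero[OF A] by (simp add: set_lebesgue_integral_def)
  qed (use k in auto)
  ultimately show ?thesis by eventually_elim (simp add: complex_eq_iff)
qed

text \<open>The Gaussian factor makes \<open>k\<close> integrable although \<open>d\<close> may not
  be, and it has no zeros, so \<open>k = 0\<close> gives back \<open>d = 0\<close>.\<close>

lemma AE_zero_if_schwartz_integrals_zero:
  fixes d :: "real^'n::finite \<Rightarrow> complex"
  assumes d: "\<And>\<psi>. \<psi> \<in> schwartz \<Longrightarrow> integrable lborel (\<lambda>x. d x * \<psi> x)"
    "\<And>\<psi>. \<psi> \<in> schwartz \<Longrightarrow> (\<integral>x. d x * \<psi> x \<partial>lborel) = 0"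
  shows "AE x in lborel. d x = 0"
proof -
  define k where "k = (\<lambda>x. d x * std_gaussian x)"
  have schwartz: "(\<lambda>x. h x * std_gaussian x) \<in> schwartz" if "h \<in> moderate" for h :: "real^'n \<Rightarrow> complex"
    using that by (rule moderate_mult_std_gaussian)
  have k: "integrable lborel (\<lambda>x. h x * k x)" "(\<integral>x. h x * k x \<partial>lborel) = 0" if "h \<in> moderate" for h
    using d[OF schwartz[OF that]] by (simp_all add: k_def mult_ac)
  \<comment> \<open>The multiplier 1 gives the integrability and the vanishing total integral
    required of \<open>k\<close>.\<close>
  have k1: "integrable lborel k" "(\<integral>x. k x \<partial>lborel) = 0"
    using k[OF moderate.const[of 1]] by simp_all
  have "(LINT x:{..a}|lborel. k x) = 0" for a
  proof -
    have "(\<lambda>N. \<integral>x. smooth_orthant N a x * k x \<partial>lborel) \<longlonglongrightarrow> (\<integral>x. indicator {..a} x * k x \<partial>lborel)"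
    proof (rule integral_dominated_convergence[where w = "\<lambda>x. norm (k x)"])
      show "AE x in lborel. norm (smooth_orthant N a x * k x) \<le> norm (k x)" for N
        using mult_right_mono[OF norm_smooth_orthant_le_1 norm_ge_zero] by (intro AE_I2) (simp add: norm_mult)
      show "AE x in lborel. (\<lambda>N. smooth_orthant N a x * k x) \<longlonglongrightarrow> indicator {..a} x * k x"
        by (intro AE_I2 tendsto_intros smooth_orthant_tendsto)
    qed (use k1 k(1)[OF smooth_orthant_moderate] in \<open>auto intro!: borel_measurable_times borel_measurable_indicator\<close>)
    then have "(\<integral>x. indicator {..a} x * k x \<partial>lborel) = 0"
      by (simp add: k(2)[OF smooth_orthant_moderate] LIMSEQ_const_iff)
    then show ?thesis
      by (simp add: set_lebesgue_integral_def scaleR_conv_of_real of_real_indicator)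
  qed
  from AE_zero_if_orthant_integrals_zero[OF k1 this]
  show ?thesis by (simp add: k_def)
qed

lemma represents_unique:
  assumes "represents g T" "represents h T"
  shows "AE x in lborel. g x = h x"
proof -
  have "AE x in lborel. g x - h x = 0"
    by (rule AE_zero_if_schwartz_integrals_zero)
       (use assms in \<open>auto simp: represents_def left_diff_distrib\<close>)
  then show ?thesis by simp
qed

lemma represents_density_of: "is_function T \<Longrightarrow> represents (density_of T) T"
  unfolding is_function_def density_of_def by (erule someI_ex)

section \<open>Chirp multiplication of distributions\<close>

text \<open>One real parameter covers both signs: the inverse of \<open>chirp c\<close> is
  \<open>chirp (- c)\<close>, and \<open>c = - pi * cot \<alpha>\<close> gives the inverse of
  M_\<alpha>.\<close>

definition chirp :: "real \<Rightarrow> real^'n::finite \<Rightarrow> complex" where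
  "chirp c x = exp (\<i> * complex_of_real (c * (norm x)\<^sup>2))"

lemma chirp_moderate: "(chirp c :: real^'n::finite \<Rightarrow> complex) \<in> moderate"
proof -
  have "chirp c = (\<lambda>x::real^'n. exp ((\<i> * complex_of_real c) * complex_of_real ((norm x)\<^sup>2)))"
    by (simp add: chirp_def fun_eq_iff mult_ac)
  then show ?thesis by (simp add: moderate.gaussian del: of_real_power)
qed

lemma norm_chirp [simp]: "norm (chirp c x) = 1"
  by (simp add: chirp_def del: of_real_mult of_real_power)

lemma chirp_minus_mult [simp]: "chirp (- c) x * chirp c x = 1"
  by (simp add: chirp_def exp_minus field_simps)

text \<open>The chirp preserves \<open>schwartz\<close>, so \<open>T\<close> may be tested on
  \<open>chirp c * \<psi>\<close>; under the integral the factor then passes from the test function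
  to \<open>g\<close>.\<close>

lemma represents_mult_chirp:
  assumes "represents g T"
  shows "represents (\<lambda>x. chirp c x * g x) (mult_distr (chirp c) T)"
proof -
  have "chirp c \<in> borel_measurable lborel"
    unfolding chirp_def by simp
  moreover have "(\<lambda>x. chirp c x * g x * \<psi> x) = (\<lambda>x. g x * (chirp c x * \<psi> x))" for \<psi>
    by (simp add: mult_ac)
  ultimately show ?thesis
    using assms moderate_mult_schwartz[OF chirp_moderate, of _ c]
    by (simp add: represents_def mult_distr_def) (auto intro: borel_measurable_times)
qed

text \<open>\<open>mult_distr\<close> resets values outside \<open>schwartz\<close> to the default,
  so recovering \<open>T\<close> as a HOL function relies on its being extensional.\<close>

lemma mult_chirp_minus_mult_chirp:
  fixes T :: "'n::finite functional"
  assumes "T \<in> extensional schwartz"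
  shows "mult_distr (chirp (- c)) (mult_distr (chirp c) T) = T"
proof (rule extensionalityI[OF _ assms])
  fix \<psi> :: "real^'n \<Rightarrow> complex" assume \<psi>: "\<psi> \<in> schwartz"
  have "(\<lambda>x. chirp c x * (chirp (- c) x * \<psi> x)) = \<psi>"
    by (simp add: mult.assoc[symmetric] chirp_minus_mult[simplified mult.commute])
  then show "mult_distr (chirp (- c)) (mult_distr (chirp c) T) \<psi> = T \<psi>"
    using \<psi> moderate_mult_schwartz[OF chirp_moderate \<psi>] by (simp add: mult_distr_def)
qed (simp add: mult_distr_def)

text \<open>For the forward direction, multiply by \<open>chirp (- c)\<close> to return to
  \<open>T\<close>. Thus the default value infinity occurs on both sides of the norm identities or
  on neither.\<close>

lemma is_function_mult_chirp:
  assumes "T \<in> extensional schwartz"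
  shows "is_function (mult_distr (chirp c) T) \<longleftrightarrow> is_function T"
  using represents_mult_chirp[of _ T c]
    represents_mult_chirp[of _ "mult_distr (chirp c) T" "- c"] mult_chirp_minus_mult_chirp[OF assms, of c]
  unfolding is_function_def by metis

text \<open>\<open>density_of\<close> chooses its two representatives independently; uniqueness ties
  them together, but only almost everywhere.\<close>

lemma norm_density_of_mult_chirp:
  assumes "T \<in> extensional schwartz" "is_function T"
  shows "AE x in lborel. norm (density_of (mult_distr (chirp c) T) x) = norm (density_of T x)"
proof -
  have "represents (density_of (mult_distr (chirp c) T)) (mult_distr (chirp c) T)"
    using assms by (intro represents_density_of) (simp add: is_function_mult_chirp)
  from represents_unique[OF this represents_mult_chirp[OF represents_density_of[OF assms(2)]]]
  show ?thesis by eventually_elim (simp add: norm_mult)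
qed

lemma Lp_norm_distr_mult_chirp:
  assumes "T \<in> extensional schwartz"
  shows "Lp_norm_distr p (mult_distr (chirp c) T) = Lp_norm_distr p T"
proof (cases "is_function T")
  case True
  \<comment> \<open>Measurability is what \<open>esssup_AE_cong\<close> asks for when
    \<open>p = \<infinity>\<close>.\<close>
  have meas: "(\<lambda>x. ennreal (norm (density_of S x))) \<in> borel_measurable lborel" 
    if "is_function S" for S :: "'a functional"
    using represents_density_of[OF that] by (auto simp: represents_def intro: borel_measurable_norm)
  have AE: "AE x in lborel. norm (density_of (mult_distr (chirp c) T) x) = norm (density_of T x)"
    by (rule norm_density_of_mult_chirp[OF assms True])
  have "Lp_norm p (\<lambda>x. ennreal (norm (density_of (mult_distr (chirp c) T) x))) =
      Lp_norm p (\<lambda>x. ennreal (norm (density_of T x)))"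
  proof (cases "p = \<infinity>")
    case True
    then show ?thesis
      using AE \<open>is_function T\<close> is_function_mult_chirp[OF assms, of c]
      unfolding Lp_norm_def by (auto intro!: esssup_AE_cong meas)
  next
    case False
    then show ?thesis
      using AE unfolding Lp_norm_def by (auto intro!: arg_cong2[where f = ennpowr] nn_integral_cong_AE)
  qed
  then show ?thesis
    using True by (simp add: Lp_norm_distr_def is_function_mult_chirp[OF assms])
qed (simp add: Lp_norm_distr_def is_function_mult_chirp[OF assms])

section \<open>Invariance of the Besov and Triebel-Lizorkin formulas\<close>

lemma besov_formula_mult_chirp:
  assumes "S \<in> extensional schwartz" "\<And>j. D j \<in> extensional schwartz"
  shows "besov_formula s p q (mult_distr (chirp c) S) (\<lambda>j. mult_distr (chirp c) (D j)) =
    besov_formula s p q S D"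
  by (simp add: besov_formula_def Lp_norm_distr_mult_chirp assms)

text \<open>Only indices from 1 on enter, which are exactly those at which
  \<open>triebel_formula\<close> guarantees that the pieces are functions.\<close>

lemma lq_norm_cong:
  assumes "\<And>j. 1 \<le> j \<Longrightarrow> a j = b j"
  shows "lq_norm q a = lq_norm q b"
  unfolding lq_norm_def using assms by (auto intro!: arg_cong2[where f = ennpowr] infsum_cong SUP_cong)

lemma triebel_formula_mult_chirp:
  assumes "S \<in> extensional schwartz" "\<And>j. D j \<in> extensional schwartz" "p < \<infinity>"
  shows "triebel_formula s p q (mult_distr (chirp c) S) (\<lambda>j. mult_distr (chirp c) (D j)) =
    triebel_formula s p q S D"
proof -
  let ?F = "\<lambda>D x. lq_norm q (\<lambda>j. ennreal (2 powr (of_int j * s)) * ennreal (norm (density_of (D j) x)))"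
  have "Lp_norm p (?F (\<lambda>j. mult_distr (chirp c) (D j))) = Lp_norm p (?F D)"
    if "\<forall>j\<ge>1. is_function (D j)"
  proof -
    \<comment> \<open>The exceptional null set depends on \<open>j\<close>; the countably many of
      them are merged into one, so that entire sequences agree at almost every point.\<close>
    have "AE x in lborel. \<forall>j\<in>{1..}. norm (density_of (mult_distr (chirp c) (D j)) x) = norm (density_of (D j) x)"
      by (rule AE_ball_countable') (use that in \<open>auto intro: norm_density_of_mult_chirp assms\<close>)
    then have "AE x in lborel. ?F (\<lambda>j. mult_distr (chirp c) (D j)) x = ?F D x"
      by eventually_elim (rule lq_norm_cong, simp)
    then show ?thesis
      using \<open>p < \<infinity>\<close> unfolding Lp_norm_def by (auto intro!: arg_cong2[where f = ennpowr] nn_integral_cong_AE)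
  qed
  then show ?thesis
    by (auto simp: triebel_formula_def Lp_norm_distr_mult_chirp is_function_mult_chirp assms)
qed

theorem theorem12p3:
  fixes \<phi> chi :: "real^'n::finite \<Rightarrow> complex"
    and s \<alpha> :: real
    and p q :: ennreal
    and u v :: "'n functional"
  assumes "dyadic_cutoff \<phi>"
    and "low_cutoff chi"
    and "\<forall>k::int. \<alpha> \<noteq> of_int k * pi"
    and "1 \<le> p"
    and "0 < q"
    and "u \<in> tempered"
    and "v = chirp_mult \<alpha> u"
  shows "besov_norm_chirp \<phi> chi \<alpha> s p q u = besov_norm \<phi> chi s p q v \<and>
    (p < \<infinity> \<longrightarrow>
       triebel_norm_chirp \<phi> chi \<alpha> s p q u = triebel_norm \<phi> chi s p q v \<and>
       sobolev_norm_chirp \<phi> chi \<alpha> s p u = sobolev_norm \<phi> chi s p v)"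
proof -
  have chirp: "chirp_mult_inv \<alpha> = (mult_distr (chirp (- pi * cot \<alpha>)) :: 'n functional \<Rightarrow> 'n functional)"
    unfolding chirp_mult_inv_def by (rule arg_cong[where f = mult_distr]) (simp add: chirp_def fun_eq_iff mult_ac)
  \<comment> \<open>The outermost operation \<open>inv_fourier_distr\<close> restricts to
    \<open>schwartz\<close>.\<close>
  have ext: "LP_low chi v \<in> extensional schwartz" "LP_block \<phi> j v \<in> extensional schwartz" for j
    by (simp_all add: LP_low_def LP_block_def inv_fourier_distr_def)
  show ?thesis
    \<comment> \<open>Folding M_\<alpha> u back to \<open>v\<close> exhibits each piece on the left
      as a chirp multiple of the classical piece of \<open>v\<close>; the Sobolev identity is the
      case \<open>q = 2\<close>.\<close>
    unfolding besov_norm_chirp_def besov_norm_def sobolev_norm_chirp_def sobolev_norm_def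
      triebel_norm_chirp_def triebel_norm_def LP_low_chirp_def LP_block_chirp_def
      \<open>v = chirp_mult \<alpha> u\<close>[symmetric] chirp
    using ext by (simp add: besov_formula_mult_chirp triebel_formula_mult_chirp)
qed

end
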